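(* Let $G$ be a group acting on a uniform space $X$. The projection $p\colon X\to X/G$ is a uniform covering map if and only if the action is neutral and there is an entourage $E_0$ of $X$ such that, for all $x\in X$ and $g\in G$, $(x,g\cdot x)\in E_0$ implies $g\cdot x=x$.
   Context: All entourages are symmetric subsets containing the diagonal. The action is a left action by bijections; the maps $x\mapsto g\cdot x$ are not assumed uniformly continuous. $X/G$ is the orbit set and $p$ the quotient map. For $f\colon X\to Y$ and $E\subset X\times X$, $f(E)=\{(f(x),f(y)) : (x,y)\in E\}$. An $E$-chain is a finite sequence $x_1,\dots,x_n$ with $(x_i,x_{i+1})\in E$ for all $i<n$. A map $f\colon X\to Y$ generates the uniform structure on $Y$ if the sets $f(E)$, $E$ an entourage of $X$, are entourages of $Y$ and form a base of its uniform structure. A surjective $f\colon X\to Y$ has the chain lifting property if for any entourage $E$ of $X$ there is an entourage $F$ of $X$ such that for every $x_0\in X$ any $f(F)$-chain in $Y$ starting from $f(x_0)$ lifts to an $E$-chain starting from $x_0$. It has the uniqueness of chain lifts property if for every entourage $E$ of $X$ there is an entourage $F$ of $X$ such that any two $F$-chains $\alpha,\beta$ with $f(\alpha)=f(\beta)$ and the same initial point are equal. A uniform covering map is a map that generates the uniform structure on its target and has both properties. The space $X/G$ is given the uniform structure generated by $p$, so that "$p$ is a uniform covering map" includes that the sets $p(E)$ form a base of a uniform structure on $X/G$ (automatic when $p$ has the chain lifting property). The action is neutral if for each entourage $E$ of $X$ there is an entourage $F$ of $X$ such that $(x,h\cdot y)\in F$ (with $x,y\in X$, $h\in G$) implies the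 existence of $g\in G$ with $(g\cdot x,y)\in E$. *)

theory Defs
  imports Complex_Main "HOL-Algebra.Group_Action"
begin

text \<open>
  The class \<^class>\<open>uniform_space\<close> lives on types, whereas an orbit set is a set of sets; uniform
  structures are therefore given on an explicit carrier, by their set of entourages. Entourages are
  symmetric by convention, so upward closure is restricted to symmetric supersets. No separation
  axiom is imposed.
\<close>

definition uniform_structure :: "'a set \<Rightarrow> ('a \<times> 'a) set set \<Rightarrow> bool" where
  "uniform_structure X \<U> \<longleftrightarrow>
     \<U> \<noteq> {} \<and>
     (\<forall>E\<in>\<U>. E \<subseteq> X \<times> X \<and> Id_on X \<subseteq> E \<and> sym E) \<and>
     (\<forall>E\<in>\<U>. \<forall>F\<in>\<U>. E \<inter> F \<in> \<U>) \<and>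
     (\<forall>E\<in>\<U>. \<forall>F. E \<subseteq> F \<and> F \<subseteq> X \<times> X \<and> sym F \<longrightarrow> F \<in> \<U>) \<and>
     (\<forall>E\<in>\<U>. \<exists>F\<in>\<U>. F O F \<subseteq> E)"

lemma uniform_structure_uniform_space:
  "uniform_structure (UNIV :: 'a::uniform_space set)
     {E. eventually (\<lambda>p. p \<in> E) uniformity \<and> sym E}"
proof -
  have comp: "\<exists>F. (eventually (\<lambda>p. p \<in> F) uniformity \<and> sym F) \<and> F O F \<subseteq> E"
    if E: "eventually (\<lambda>p. p \<in> E) uniformity" for E :: "('a \<times> 'a) set"
  proof -
    obtain D where D: "eventually D uniformity"
      and DE: "\<And>x y z. D (x, y) \<Longrightarrow> D (y, z) \<Longrightarrow> (x, z) \<in> E"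
      using uniformity_transE[OF E] by blast
    have "eventually (\<lambda>(x, y). D (y, x)) uniformity"
      using D by (rule uniformity_sym)
    with D have "eventually (\<lambda>p. D p \<and> (case p of (x, y) \<Rightarrow> D (y, x))) uniformity"
      by (rule eventually_conj)
    then have "eventually (\<lambda>p. p \<in> {(x, y). D (x, y) \<and> D (y, x)}) uniformity"
      by (rule eventually_mono) auto
    moreover have "sym {(x, y). D (x, y) \<and> D (y, x)}"
      by (auto simp: sym_def)
    moreover have "{(x, y). D (x, y) \<and> D (y, x)} O {(x, y). D (x, y) \<and> D (y, x)} \<subseteq> E"
      using DE by auto
    ultimately show ?thesis by blast
  qed
  have refl: "Id_on UNIV \<subseteq> E" if "eventually (\<lambda>p. p \<in> E) uniformity" for E :: "('a \<times> 'a) set"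
    using uniformity_refl[OF that] by auto
  have up: "eventually (\<lambda>p. p \<in> F) uniformity"
    if "eventually (\<lambda>p. p \<in> E) uniformity" "E \<subseteq> F" for E F :: "('a \<times> 'a) set"
    using that by (auto elim: eventually_mono)
  have ne: "{E :: ('a \<times> 'a) set. eventually (\<lambda>p. p \<in> E) uniformity \<and> sym E} \<noteq> {}"
    by (auto simp: sym_def intro!: exI[of _ UNIV])
  show ?thesis
    unfolding uniform_structure_def
    by (rule conjI[OF ne]) (use comp refl up in \<open>auto simp: eventually_conj_iff sym_Int\<close>)
qed

definition image_rel :: "('a \<Rightarrow> 'b) \<Rightarrow> ('a \<times> 'a) set \<Rightarrow> ('b \<times> 'b) set" where
  "image_rel f E = {(f x, f y) | x y. (x, y) \<in> E}"

text \<open>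
  Chains are nonempty. Membership in the carrier is explicit because the step condition says nothing
  about a one-point chain.
\<close>

definition is_chain :: "'a set \<Rightarrow> ('a \<times> 'a) set \<Rightarrow> 'a list \<Rightarrow> bool" where
  "is_chain X E xs \<longleftrightarrow> xs \<noteq> [] \<and> set xs \<subseteq> X \<and> successively (\<lambda>x y. (x, y) \<in> E) xs"

definition generates_uniformity ::
  "('a \<times> 'a) set set \<Rightarrow> ('b \<times> 'b) set set \<Rightarrow> ('a \<Rightarrow> 'b) \<Rightarrow> bool" where
  "generates_uniformity \<U> \<V> f \<longleftrightarrow>
     (\<forall>E\<in>\<U>. image_rel f E \<in> \<V>) \<and> (\<forall>D\<in>\<V>. \<exists>E\<in>\<U>. image_rel f E \<subseteq> D)"

definition chain_lifting ::
  "'a set \<Rightarrow> ('a \<times> 'a) set set \<Rightarrow> 'b set \<Rightarrow> ('a \<Rightarrow> 'b) \<Rightarrow> bool" where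
  "chain_lifting X \<U> Y f \<longleftrightarrow>
     (\<forall>E\<in>\<U>. \<exists>F\<in>\<U>. \<forall>x\<^sub>0\<in>X. \<forall>ys. is_chain Y (image_rel f F) ys \<and> hd ys = f x\<^sub>0 \<longrightarrow>
        (\<exists>xs. is_chain X E xs \<and> hd xs = x\<^sub>0 \<and> map f xs = ys))"

definition unique_chain_lifts ::
  "'a set \<Rightarrow> ('a \<times> 'a) set set \<Rightarrow> ('a \<Rightarrow> 'b) \<Rightarrow> bool" where
  "unique_chain_lifts X \<U> f \<longleftrightarrow>
     (\<forall>E\<in>\<U>. \<exists>F\<in>\<U>. \<forall>\<alpha> \<beta>. is_chain X F \<alpha> \<and> is_chain X F \<beta> \<and>
        map f \<alpha> = map f \<beta> \<and> hd \<alpha> = hd \<beta> \<longrightarrow> \<alpha> = \<beta>)"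

definition uniform_covering_map ::
  "'a set \<Rightarrow> ('a \<times> 'a) set set \<Rightarrow> 'b set \<Rightarrow> ('b \<times> 'b) set set \<Rightarrow> ('a \<Rightarrow> 'b) \<Rightarrow> bool" where
  "uniform_covering_map X \<U> Y \<V> f \<longleftrightarrow>
     uniform_structure X \<U> \<and> uniform_structure Y \<V> \<and> f ` X = Y \<and>
     generates_uniformity \<U> \<V> f \<and> chain_lifting X \<U> Y f \<and> unique_chain_lifts X \<U> f"

text \<open>
  The only family of symmetric relations on \<open>Y\<close> that can be a uniform structure with base the sets
  \<open>f(E)\<close>. It need not be one in general; this is part of \<^const>\<open>uniform_covering_map\<close>.
\<close>

definition generated_uniformity ::
  "('a \<times> 'a) set set \<Rightarrow> 'b set \<Rightarrow> ('a \<Rightarrow> 'b) \<Rightarrow> ('b \<times> 'b) set set" where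
  "generated_uniformity \<U> Y f = {D. D \<subseteq> Y \<times> Y \<and> sym D \<and> (\<exists>E\<in>\<U>. image_rel f E \<subseteq> D)}"

definition neutral_action ::
  "('g, 'm) monoid_scheme \<Rightarrow> 'a set \<Rightarrow> ('g \<Rightarrow> 'a \<Rightarrow> 'a) \<Rightarrow> ('a \<times> 'a) set set \<Rightarrow> bool" where
  "neutral_action G X \<phi> \<U> \<longleftrightarrow>
     (\<forall>E\<in>\<U>. \<exists>F\<in>\<U>. \<forall>x\<in>X. \<forall>y\<in>X. \<forall>h\<in>carrier G.
        (x, \<phi> h y) \<in> F \<longrightarrow> (\<exists>g\<in>carrier G. (\<phi> g x, y) \<in> E))"

end

theory Submission
  imports Defs
begin

text \<open>
  Chains are built step by step, so each half of the definition of a uniform covering map can be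
  tested on a single step. For a surjection \<open>f\<close>, chain lifting says that a small step of the base
  leaving \<open>f x\<close> is the image of a small step leaving \<open>x\<close> (\<open>chain_lifting_iff_step\<close>). Uniqueness of
  lifts says that \<open>f\<close> identifies no two distinct points that are close to each other
  (\<open>unique_chain_lifts_iff_separated_fibres\<close>): two lifts that agree up to some point continue to
  points which are both near that point, hence near each other, and which lie in one fibre.

  The fibres of the orbit map are the orbits, so for this map the one-step criteria become
  neutrality and the condition on \<open>E\<^sub>0\<close>. Indeed, a step between the orbits of \<open>y\<close> and \<open>x\<close> is witnessed
  by some \<open>(x, h \<cdot> y) \<in> F\<close> after a change of representatives, and a lift of it that starts at \<open>y\<close> is a
  point \<open>g \<cdot> x\<close> that is \<open>E\<close>-close to \<open>y\<close>.

  Finally, chain lifting makes the sets \<open>f(E)\<close> a base of a uniform structure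
  (\<open>chain_lifting_imp_uniform_structure\<close>). The only axiom that can fail is the one on composition, and
  it is obtained by lifting chains with two steps.
\<close>

lemma uniform_structureD:
  assumes "uniform_structure X \<U>" and "E \<in> \<U>"
  shows "E \<subseteq> X \<times> X" and "Id_on X \<subseteq> E" and "sym E" and "\<exists>F\<in>\<U>. F O F \<subseteq> E"
    and "F \<in> \<U> \<Longrightarrow> E \<inter> F \<in> \<U>"
proof -
  from assms(1) have
    "\<forall>E\<in>\<U>. E \<subseteq> X \<times> X \<and> Id_on X \<subseteq> E \<and> sym E" "\<forall>E\<in>\<U>. \<forall>F\<in>\<U>. E \<inter> F \<in> \<U>"
    "\<forall>E\<in>\<U>. \<exists>F\<in>\<U>. F O F \<subseteq> E"
    unfolding uniform_structure_def by - (elim conjE, assumption)+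
  with assms(2) show "E \<subseteq> X \<times> X" "Id_on X \<subseteq> E" "sym E" "\<exists>F\<in>\<U>. F O F \<subseteq> E"
    "F \<in> \<U> \<Longrightarrow> E \<inter> F \<in> \<U>"
    by auto
qed

lemma uniform_structure_nonempty: "uniform_structure X \<U> \<Longrightarrow> \<U> \<noteq> {}"
  unfolding uniform_structure_def by (rule conjunct1)

section \<open>Testing chain lifting and uniqueness on single steps\<close>

lemma chain_lifting_iff_step:
  assumes U: "uniform_structure X \<U>" and surj: "f ` X = Y"
  shows "chain_lifting X \<U> Y f \<longleftrightarrow>
    (\<forall>E\<in>\<U>. \<exists>F\<in>\<U>. \<forall>x\<in>X. \<forall>y. (f x, y) \<in> image_rel f F \<longrightarrow> (\<exists>x'\<in>X. (x, x') \<in> E \<and> f x' = y))"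
proof
  assume lift: "chain_lifting X \<U> Y f"
  show "\<forall>E\<in>\<U>. \<exists>F\<in>\<U>. \<forall>x\<in>X. \<forall>y. (f x, y) \<in> image_rel f F \<longrightarrow> (\<exists>x'\<in>X. (x, x') \<in> E \<and> f x' = y)"
  proof
    fix E assume "E \<in> \<U>"
    with lift obtain F where F: "F \<in> \<U>"
      and Flift: "\<And>x ys. x \<in> X \<Longrightarrow> is_chain Y (image_rel f F) ys \<Longrightarrow> hd ys = f x \<Longrightarrow>
        \<exists>xs. is_chain X E xs \<and> hd xs = x \<and> map f xs = ys"
      unfolding chain_lifting_def by meson
    have "\<exists>x'\<in>X. (x, x') \<in> E \<and> f x' = y" if x: "x \<in> X" and xy: "(f x, y) \<in> image_rel f F" for x y
    proof -
      have "y \<in> Y"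
        using xy uniform_structureD(1)[OF U F] surj by (auto simp: image_rel_def)
      then have "is_chain Y (image_rel f F) [f x, y]"
        using x xy surj by (auto simp: is_chain_def)
      from Flift[OF x this] show ?thesis
        by (auto simp: is_chain_def map_eq_Cons_conv)
    qed
    with F show "\<exists>F\<in>\<U>. \<forall>x\<in>X. \<forall>y. (f x, y) \<in> image_rel f F \<longrightarrow> (\<exists>x'\<in>X. (x, x') \<in> E \<and> f x' = y)"
      by blast
  qed
next
  assume step: "\<forall>E\<in>\<U>. \<exists>F\<in>\<U>. \<forall>x\<in>X. \<forall>y. (f x, y) \<in> image_rel f F \<longrightarrow>
    (\<exists>x'\<in>X. (x, x') \<in> E \<and> f x' = y)"
  have "\<exists>F\<in>\<U>. \<forall>x\<in>X. \<forall>ys. is_chain Y (image_rel f F) ys \<and> hd ys = f x \<longrightarrow>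
      (\<exists>xs. is_chain X E xs \<and> hd xs = x \<and> map f xs = ys)" if "E \<in> \<U>" for E
  proof -
    from step that obtain F where F: "F \<in> \<U>" and Fstep:
      "\<And>x y. x \<in> X \<Longrightarrow> (f x, y) \<in> image_rel f F \<Longrightarrow> \<exists>x'\<in>X. (x, x') \<in> E \<and> f x' = y"
      by meson
    have "\<exists>xs. is_chain X E xs \<and> hd xs = x \<and> map f xs = ys"
      if "is_chain Y (image_rel f F) ys" "hd ys = f x" "x \<in> X" for x ys
      using that
    proof (induction ys arbitrary: x)
      case Nil
      then show ?case by (simp add: is_chain_def)
    next
      case (Cons y ys)
      show ?case
      proof (cases ys)
        case Nil
        with Cons.prems show ?thesis
          by (intro exI[of _ "[x]"]) (simp add: is_chain_def)
      next
        case (Cons y' ys')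
        with Cons.prems have "(f x, y') \<in> image_rel f F" and ys: "is_chain Y (image_rel f F) ys"
          by (auto simp: is_chain_def)
        with Fstep \<open>x \<in> X\<close> obtain x' where x': "x' \<in> X" "(x, x') \<in> E" "f x' = y'"
          by blast
        from Cons x'(3) have "hd ys = f x'"
          by simp
        with Cons.IH[OF ys] x'(1) obtain xs where "is_chain X E xs" "hd xs = x'" "map f xs = ys"
          by blast
        with x' Cons.prems show ?thesis
          by (intro exI[of _ "x # xs"]) (auto simp: is_chain_def successively_Cons)
      qed
    qed
    with F show ?thesis by blast
  qed
  then show "chain_lifting X \<U> Y f"
    unfolding chain_lifting_def by blast
qed

lemma unique_chain_lifts_iff_separated_fibres:
  assumes U: "uniform_structure X \<U>"
  shows "unique_chain_lifts X \<U> f \<longleftrightarrow> (\<exists>E\<in>\<U>. \<forall>x x'. (x, x') \<in> E \<and> f x = f x' \<longrightarrow> x = x')"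
proof
  assume uniq: "unique_chain_lifts X \<U> f"
  from uniform_structure_nonempty[OF U] obtain E where "E \<in> \<U>"
    by blast
  with uniq obtain F where F: "F \<in> \<U>" and Funiq:
    "\<And>\<alpha> \<beta>. is_chain X F \<alpha> \<Longrightarrow> is_chain X F \<beta> \<Longrightarrow> map f \<alpha> = map f \<beta> \<Longrightarrow> hd \<alpha> = hd \<beta> \<Longrightarrow> \<alpha> = \<beta>"
    unfolding unique_chain_lifts_def by meson
  have "x = x'" if "(x, x') \<in> F" "f x = f x'" for x x'
  proof -
    have "x \<in> X" "x' \<in> X" "(x, x) \<in> F"
      using uniform_structureD(1,2)[OF U F] that(1) by auto
    \<comment> \<open>A stationary step at \<open>x\<close> and the step from \<open>x\<close> to \<open>x'\<close> have the same image.\<close>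
    then have "[x, x] = [x, x']"
      using that by (intro Funiq) (auto simp: is_chain_def)
    then show ?thesis by simp
  qed
  with F show "\<exists>E\<in>\<U>. \<forall>x x'. (x, x') \<in> E \<and> f x = f x' \<longrightarrow> x = x'"
    by blast
next
  assume "\<exists>E\<in>\<U>. \<forall>x x'. (x, x') \<in> E \<and> f x = f x' \<longrightarrow> x = x'"
  then obtain E where E: "E \<in> \<U>" and Esep: "\<And>x x'. (x, x') \<in> E \<Longrightarrow> f x = f x' \<Longrightarrow> x = x'"
    by blast
  from uniform_structureD(4)[OF U E] obtain F where F: "F \<in> \<U>" and FF: "F O F \<subseteq> E"
    by blast
  note symF = uniform_structureD(3)[OF U F]
  have "\<alpha> = \<beta>" if "is_chain X F \<alpha>" "is_chain X F \<beta>" "map f \<alpha> = map f \<beta>" "hd \<alpha> = hd \<beta>" for \<alpha> \<beta>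
    using that
  proof (induction \<alpha> arbitrary: \<beta>)
    case Nil
    then show ?case by simp
  next
    case (Cons a \<alpha>)
    then obtain \<beta>' where \<beta>: "\<beta> = a # \<beta>'" "map f \<alpha> = map f \<beta>'"
      by (cases \<beta>) auto
    show ?case
    proof (cases \<alpha>)
      case Nil
      with \<beta> show ?thesis by simp
    next
      case (Cons b \<alpha>')
      with \<beta> obtain c \<beta>'' where \<beta>': "\<beta>' = c # \<beta>''" "f b = f c"
        by (cases \<beta>') auto
      from Cons \<beta> \<beta>' Cons.prems(1,2)
      have steps: "(a, b) \<in> F" "(a, c) \<in> F" "is_chain X F \<alpha>" "is_chain X F \<beta>'"
        by (auto simp: is_chain_def)
      from steps(1) symF have "(b, a) \<in> F"
        by (rule symD[rotated])
      with steps(2) FF have "(b, c) \<in> E"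
        by blast
      with \<beta>'(2) have "b = c"
        by (intro Esep)
      with Cons \<beta>'(1) Cons.IH[OF steps(3,4) \<beta>(2)] \<beta>(1) show ?thesis
        by simp
    qed
  qed
  with F show "unique_chain_lifts X \<U> f"
    unfolding unique_chain_lifts_def by blast
qed

section \<open>The uniform structure generated by a map\<close>

lemma image_rel_in_generated_uniformity:
  assumes "uniform_structure X \<U>" and "f ` X = Y" and "E \<in> \<U>"
  shows "image_rel f E \<in> generated_uniformity \<U> Y f"
proof -
  have "image_rel f E \<subseteq> Y \<times> Y"
    using uniform_structureD(1)[OF assms(1,3)] assms(2) by (auto simp: image_rel_def)
  moreover have "sym (image_rel f E)"
    using uniform_structureD(3)[OF assms(1,3)] unfolding sym_def image_rel_def by blast
  moreover note assms(3)
  ultimately show ?thesis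
    unfolding generated_uniformity_def by blast
qed

text \<open>
  If \<open>E' O E' \<subseteq> E\<close> and \<open>f(F)\<close>-steps lift to \<open>E'\<close>-steps from any prescribed initial point, then two
  consecutive \<open>f(F)\<close>-steps lift to two consecutive \<open>E'\<close>-steps. So \<open>f(F)\<close> composed with itself lies in
  \<open>f(E)\<close>. Freedom in the choice of the initial point is essential: arbitrary representatives of the
  two steps need not meet in the middle.
\<close>

lemma chain_lifting_imp_uniform_structure:
  assumes U: "uniform_structure X \<U>" and surj: "f ` X = Y" and lift: "chain_lifting X \<U> Y f"
  shows "uniform_structure Y (generated_uniformity \<U> Y f)"
  unfolding uniform_structure_def
proof (intro conjI ballI allI impI)
  let ?\<V> = "generated_uniformity \<U> Y f"
  show "?\<V> \<noteq> {}"
    using uniform_structure_nonempty[OF U] image_rel_in_generated_uniformity[OF U surj] by blast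
next
  fix D assume D: "D \<in> generated_uniformity \<U> Y f"
  then show "D \<subseteq> Y \<times> Y" "sym D"
    by (auto simp: generated_uniformity_def)
  obtain E where E: "E \<in> \<U>" "image_rel f E \<subseteq> D"
    using D by (auto simp: generated_uniformity_def)
  then have "Id_on X \<subseteq> E"
    using uniform_structureD(2)[OF U] by blast
  then have "Id_on Y \<subseteq> image_rel f E"
    using surj by (fastforce simp: image_rel_def)
  with E show "Id_on Y \<subseteq> D"
    by blast
next
  fix D D' assume D: "D \<in> generated_uniformity \<U> Y f" and D': "D' \<in> generated_uniformity \<U> Y f"
  then obtain E E' where "E \<in> \<U>" "E' \<in> \<U>" "image_rel f E \<subseteq> D" "image_rel f E' \<subseteq> D'"
    by (auto simp: generated_uniformity_def)
  moreover from this(1,2) have "E \<inter> E' \<in> \<U>"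
    by (rule uniform_structureD(5)[OF U])
  moreover have "image_rel f (E \<inter> E') \<subseteq> image_rel f E \<inter> image_rel f E'"
    by (auto simp: image_rel_def)
  ultimately have "\<exists>E\<in>\<U>. image_rel f E \<subseteq> D \<inter> D'"
    by blast
  with D D' show "D \<inter> D' \<in> generated_uniformity \<U> Y f"
    by (auto simp: generated_uniformity_def sym_Int)
next
  fix D D' assume "D \<in> generated_uniformity \<U> Y f" "D \<subseteq> D' \<and> D' \<subseteq> Y \<times> Y \<and> sym D'"
  then show "D' \<in> generated_uniformity \<U> Y f"
    unfolding generated_uniformity_def by blast
next
  fix D assume "D \<in> generated_uniformity \<U> Y f"
  then obtain E where E: "E \<in> \<U>" "image_rel f E \<subseteq> D"
    by (auto simp: generated_uniformity_def)
  then obtain E' where E': "E' \<in> \<U>" "E' O E' \<subseteq> E"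
    using uniform_structureD(4)[OF U] by blast
  with lift obtain F where F: "F \<in> \<U>" and Fstep:
    "\<And>x y. x \<in> X \<Longrightarrow> (f x, y) \<in> image_rel f F \<Longrightarrow> \<exists>x'\<in>X. (x, x') \<in> E' \<and> f x' = y"
    unfolding chain_lifting_iff_step[OF U surj] by meson
  have "(u, w) \<in> D" if uv: "(u, v) \<in> image_rel f F" and vw: "(v, w) \<in> image_rel f F" for u v w
  proof -
    obtain x where x: "x \<in> X" "u = f x"
      using uv uniform_structureD(1)[OF U F] by (auto simp: image_rel_def)
    with uv Fstep obtain x' where x': "x' \<in> X" "(x, x') \<in> E'" "v = f x'"
      by blast
    with vw Fstep obtain x'' where x'': "(x', x'') \<in> E'" "w = f x''"
      by blast
    from x'(2) x''(1) E'(2) have "(x, x'') \<in> E"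
      by blast
    with x(2) x''(2) E(2) show ?thesis
      by (auto simp: image_rel_def)
  qed
  then have "image_rel f F O image_rel f F \<subseteq> D"
    by blast
  with image_rel_in_generated_uniformity[OF U surj F]
  show "\<exists>F\<in>generated_uniformity \<U> Y f. F O F \<subseteq> D"
    by blast
qed

lemma uniform_covering_map_generated_iff:
  assumes U: "uniform_structure X \<U>" and surj: "f ` X = Y"
  shows "uniform_covering_map X \<U> Y (generated_uniformity \<U> Y f) f \<longleftrightarrow>
    chain_lifting X \<U> Y f \<and> unique_chain_lifts X \<U> f"
proof -
  have "generates_uniformity \<U> (generated_uniformity \<U> Y f) f"
    using image_rel_in_generated_uniformity[OF U surj]
    by (auto simp: generates_uniformity_def generated_uniformity_def)
  then show ?thesis
    using assms chain_lifting_imp_uniform_structure[OF assms]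
    by (auto simp: uniform_covering_map_def)
qed

section \<open>The orbit map\<close>

lemma (in group_action) orbit_eq_iff:
  assumes "x \<in> E" "y \<in> E"
  shows "orbit G \<phi> x = orbit G \<phi> y \<longleftrightarrow> (\<exists>g\<in>carrier G. x = \<phi> g y)"
proof -
  have "orbit G \<phi> x = orbit G \<phi> y \<longleftrightarrow> x \<in> orbit G \<phi> y"
  proof
    assume "orbit G \<phi> x = orbit G \<phi> y"
    with orbit_refl[OF assms(1)] show "x \<in> orbit G \<phi> y" by simp
  next
    assume x: "x \<in> orbit G \<phi> y"
    then have "orbit G \<phi> x \<inter> orbit G \<phi> y \<noteq> {}"
      using orbit_refl[OF assms(1)] by blast
    then show "orbit G \<phi> x = orbit G \<phi> y"
      using disjoint_union[of "orbit G \<phi> x" "orbit G \<phi> y"] assms by (auto simp: orbits_def)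
  qed
  then show ?thesis
    by (auto simp: orbit_def)
qed

text \<open>
  Neutrality at \<open>(x, h \<cdot> y) \<in> F\<close> is the lifting, from the initial point \<open>y\<close>, of the step that goes from
  the orbit of \<open>y\<close> to the orbit of \<open>x\<close>. The step runs backwards with respect to the pair, which the
  symmetry of entourages permits.
\<close>

lemma (in group_action) chain_lifting_orbit_iff_neutral:
  assumes U: "uniform_structure E \<U>"
  shows "chain_lifting E \<U> (orbits G E \<phi>) (orbit G \<phi>) \<longleftrightarrow> neutral_action G E \<phi> \<U>"
proof -
  have surj: "orbit G \<phi> ` E = orbits G E \<phi>"
    by (auto simp: orbits_def)
  have carr: "A \<subseteq> E \<times> E" and sym: "(x, y) \<in> A \<longleftrightarrow> (y, x) \<in> A" if "A \<in> \<U>" for A x y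
    using uniform_structureD(1,3)[OF U that] by (blast dest: symD)+
  have step_iff: "(\<forall>x\<in>E. \<forall>c. (orbit G \<phi> x, c) \<in> image_rel (orbit G \<phi>) B \<longrightarrow>
          (\<exists>x'\<in>E. (x, x') \<in> A \<and> orbit G \<phi> x' = c)) \<longleftrightarrow>
        (\<forall>x\<in>E. \<forall>y\<in>E. \<forall>h\<in>carrier G. (x, \<phi> h y) \<in> B \<longrightarrow> (\<exists>g\<in>carrier G. (\<phi> g x, y) \<in> A))"
    (is "?step \<longleftrightarrow> ?neutral") if A: "A \<in> \<U>" and B: "B \<in> \<U>" for A B
  proof
    assume step: ?step
    show ?neutral
    proof (intro ballI impI)
      fix x y h assume x: "x \<in> E" and y: "y \<in> E" and h: "h \<in> carrier G" and xy: "(x, \<phi> h y) \<in> B"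
      have "orbit G \<phi> (\<phi> h y) = orbit G \<phi> y"
        using h y element_image by (subst orbit_eq_iff) auto
      moreover have "(\<phi> h y, x) \<in> B"
        using xy sym[OF B] by blast
      ultimately have "(orbit G \<phi> y, orbit G \<phi> x) \<in> image_rel (orbit G \<phi>) B"
        unfolding image_rel_def by (intro CollectI exI[of _ "\<phi> h y"] exI[of _ x]) simp
      with step y obtain x' where "x' \<in> E" "(y, x') \<in> A" "orbit G \<phi> x' = orbit G \<phi> x"
        by blast
      then show "\<exists>g\<in>carrier G. (\<phi> g x, y) \<in> A"
        using x orbit_eq_iff sym[OF A] by blast
    qed
  next
    assume neutral: ?neutral
    show ?step
    proof (intro ballI allI impI)
      fix y c assume y: "y \<in> E" and "(orbit G \<phi> y, c) \<in> image_rel (orbit G \<phi>) B"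
      then obtain u x where ux: "(u, x) \<in> B" "orbit G \<phi> u = orbit G \<phi> y" "c = orbit G \<phi> x"
        by (auto simp: image_rel_def)
      with carr[OF B] have x: "x \<in> E" and "u \<in> E"
        by auto
      with ux(2) y obtain h where h: "h \<in> carrier G" "u = \<phi> h y"
        using orbit_eq_iff by blast
      with ux(1) sym[OF B] have "(x, \<phi> h y) \<in> B"
        by blast
      with neutral x y h(1) obtain g where g: "g \<in> carrier G" "(\<phi> g x, y) \<in> A"
        by blast
      then have "\<phi> g x \<in> E" "orbit G \<phi> (\<phi> g x) = orbit G \<phi> x"
        using x element_image by (auto simp: orbit_eq_iff)
      with g(2) ux(3) sym[OF A] show "\<exists>x'\<in>E. (y, x') \<in> A \<and> orbit G \<phi> x' = c"
        by blast
    qed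
  qed
  show ?thesis
    unfolding chain_lifting_iff_step[OF U surj] neutral_action_def
    by (rule ball_cong[OF refl], rule bex_cong[OF refl], rule step_iff)
qed

lemma (in group_action) unique_chain_lifts_orbit_iff:
  assumes U: "uniform_structure E \<U>"
  shows "unique_chain_lifts E \<U> (orbit G \<phi>) \<longleftrightarrow>
    (\<exists>A\<in>\<U>. \<forall>x\<in>E. \<forall>g\<in>carrier G. (x, \<phi> g x) \<in> A \<longrightarrow> \<phi> g x = x)"
  unfolding unique_chain_lifts_iff_separated_fibres[OF U]
proof (intro bex_cong refl)
  fix A assume "A \<in> \<U>"
  then have carr: "A \<subseteq> E \<times> E"
    by (rule uniform_structureD(1)[OF U])
  show "(\<forall>x x'. (x, x') \<in> A \<and> orbit G \<phi> x = orbit G \<phi> x' \<longrightarrow> x = x') \<longleftrightarrow>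
    (\<forall>x\<in>E. \<forall>g\<in>carrier G. (x, \<phi> g x) \<in> A \<longrightarrow> \<phi> g x = x)"
  proof safe
    fix x g assume sep: "\<forall>x x'. (x, x') \<in> A \<and> orbit G \<phi> x = orbit G \<phi> x' \<longrightarrow> x = x'"
      and x: "x \<in> E" and g: "g \<in> carrier G" and close: "(x, \<phi> g x) \<in> A"
    have "orbit G \<phi> (\<phi> g x) = orbit G \<phi> x"
      using x g element_image by (subst orbit_eq_iff) auto
    with sep close show "\<phi> g x = x"
      by metis
  next
    fix x x' assume free: "\<forall>x\<in>E. \<forall>g\<in>carrier G. (x, \<phi> g x) \<in> A \<longrightarrow> \<phi> g x = x"
      and close: "(x, x') \<in> A" and eq: "orbit G \<phi> x = orbit G \<phi> x'"
    from close carr have "x \<in> E" "x' \<in> E"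
      by auto
    moreover from this eq obtain g where "g \<in> carrier G" "x' = \<phi> g x"
      using orbit_eq_iff[of x' x] by auto
    ultimately show "x = x'"
      using free close by metis
  qed
qed

theorem corollary3p3:
  fixes G :: "('g, 'm) monoid_scheme"
    and X :: "'a set"
    and \<U> :: "('a \<times> 'a) set set"
    and \<phi> :: "'g \<Rightarrow> 'a \<Rightarrow> 'a"
  assumes "uniform_structure X \<U>"
    and "group_action G X \<phi>"
  shows "uniform_covering_map X \<U> (orbits G X \<phi>)
           (generated_uniformity \<U> (orbits G X \<phi>) (orbit G \<phi>)) (orbit G \<phi>)
         \<longleftrightarrow>
         neutral_action G X \<phi> \<U> \<and>
         (\<exists>E\<^sub>0\<in>\<U>. \<forall>x\<in>X. \<forall>g\<in>carrier G. (x, \<phi> g x) \<in> E\<^sub>0 \<longrightarrow> \<phi> g x = x)"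
proof -
  have surj: "orbit G \<phi> ` X = orbits G X \<phi>"
    by (auto simp: orbits_def)
  show ?thesis
    using uniform_covering_map_generated_iff[OF assms(1) surj]
      group_action.chain_lifting_orbit_iff_neutral[OF assms(2,1)]
      group_action.unique_chain_lifts_orbit_iff[OF assms(2,1)]
    by simp
qed

end
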